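(* Let $r<m$ be positive integers, let $B\in\mathbb{R}^{r\times m}$ have rank $r$, let $\Lambda\in\mathbb{R}^{m\times m}$ be a (constant) diagonal matrix whose diagonal entries lie in $(0,1]$, and let $(v(k))_{k\ge 0}$ be a bounded sequence in $\mathbb{R}^r$. Let $A_m\in\mathbb{R}^{r\times r}$ be a matrix all of whose eigenvalues are inside the unit circle, such that the pair $(A_m,B\Lambda)$ satisfies Assumption 1 (stated in the context). Let $\Gamma=\Gamma^T\in\mathbb{R}^{r\times r}$ be positive definite. With arbitrary initial values $\xi(0),\xi_m(0)\in\mathbb{R}^r$ and $\theta_v(0)\in\mathbb{R}^{r\times m}$, consider for $k=0,1,2,\dots$ $$u(k)=\theta_v^T(k)v(k),$$ $$\xi(k+1)=A_m\xi(k)+B\Lambda u(k)-v(k),\qquad \xi_m(k+1)=A_m\xi_m(k),$$ and the error $e(k)=\xi(k)-\xi_m(k)$, which obeys $$e(k+1)=A_me(k)+B\Lambda\tilde\theta_v^T(k)v(k).$$ Suppose that the parameter matrix $\theta_v(k)\in\mathbb{R}^{r\times m}$ is updated by $$\theta_v(k+1)=\theta_v(k)+\Gamma v(k)\epsilon^T(k)B,\qquad \epsilon(k)=\frac{v(k)-B\Lambda u(k)}{\sigma^2(k)},$$ $$\sigma(k)=\sqrt{1+\lambda_{\max}(B\Lambda B^T)\,v^T(k)\Gamma v(k)}.$$ Then the adaptive parameter $\theta_v(k)$, the error signal $e(k)$ and all signals (that is, also $\xi(k)$, $\xi_m(k)$, $u(k)$ and $\epsilon(k)$) remain bounded over $k\ge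 0$. Furthermore, $\lim_{k\to\infty}e(k)=0$.
   Context: $\lambda_{\max}(\cdot)$ denotes the maximum eigenvalue of a symmetric matrix. The ideal parameter is $\theta_v^*=\big((B\Lambda)^T(B\Lambda\Lambda B^T)^{-1}\big)^T\in\mathbb{R}^{r\times m}$, so that $\theta_v^{*T}$ is the pseudo-inverse of $B\Lambda$, and $\tilde\theta_v(k)=\theta_v(k)-\theta_v^*$. Assumption 1 for a pair $(M,N)$ with $M\in\mathbb{R}^{r\times r}$ and $N\in\mathbb{R}^{r\times m}$: (i) $|\lambda_i(M)|\le 1$ for every eigenvalue $\lambda_i(M)$, $i=1,\dots,r$; (ii) all controllable modes of $(M,N)$ are inside the unit circle (i.e. have modulus strictly less than $1$); (iii) the eigenvalues of $M$ on the unit circle have Jordan blocks of size one. A sequence of vectors or matrices is bounded if the supremum over $k\ge 0$ of the absolute values of all its entries is finite. *)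

theory Defs
  imports "Jordan_Normal_Form.Jordan_Normal_Form" "HOL-Analysis.Analysis"
begin

(* "$" and the dot product below refer to the vectors and matrices of HOL-Analysis only. *)
no_notation vec_index (infixl "$" 100)
no_notation scalar_prod (infix "\<bullet>" 70)

definition eigenvalues :: "'a::field^'n^'n \<Rightarrow> 'a set" where
  "eigenvalues M = {\<mu>. \<exists>x. x \<noteq> 0 \<and> M *v x = \<mu> *s x}"

abbreviation complex_matrix :: "real^'m^'n \<Rightarrow> complex^'m^'n" where
  "complex_matrix \<equiv> map_matrix complex_of_real"

(* Used for symmetric matrices only: there the set of real eigenvalues is nonempty and finite. *)
definition lambda_max :: "real^'n^'n \<Rightarrow> real" where
  "lambda_max S = Max (eigenvalues S)"

(* Range of the controllability matrix [N, M N, ..., M^(n-1) N], where M is n x n.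
   vec.span is the span over the field 'a, so over the complex numbers if 'a is complex. *)
definition controllable_subspace :: "'a::field^'n^'n \<Rightarrow> 'a^'m^'n \<Rightarrow> ('a^'n) set" where
  "controllable_subspace M N =
     vec.span {((*v) M ^^ k) (column j N) | k j. k < CARD('n)}"

(* The modes of the controllable part in the Kalman decomposition, that is, the eigenvalues of
   the restriction of M to its invariant subspace of controllable states. *)
definition controllable_modes :: "real^'n^'n \<Rightarrow> real^'m^'n \<Rightarrow> complex set" where
  "controllable_modes M N =
     {\<mu>. \<exists>x \<in> controllable_subspace (complex_matrix M) (complex_matrix N).
            x \<noteq> 0 \<and> complex_matrix M *v x = \<mu> *s x}"

(* Conversion to the matrices of Jordan_Normal_Form. The index type is enumerated in an arbitrary
   order; another order gives a permutation-similar matrix, hence the same Jordan blocks. *)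
definition to_jnf_mat :: "'a^'n^'n \<Rightarrow> 'a mat" where
  "to_jnf_mat M = Matrix.mat CARD('n) CARD('n)
     (\<lambda>(i, j). M $ from_nat_into (UNIV :: 'n set) i $ from_nat_into (UNIV :: 'n set) j)"

(* In n_as, a pair (n, a) stands for a Jordan block of size n with eigenvalue a. *)
definition assumption1 :: "real^'n^'n \<Rightarrow> real^'m^'n \<Rightarrow> bool" where
  "assumption1 M N \<longleftrightarrow>
     (\<forall>\<mu> \<in> eigenvalues (complex_matrix M). cmod \<mu> \<le> 1) \<and>
     (\<forall>\<mu> \<in> controllable_modes M N. cmod \<mu> < 1) \<and>
     (\<exists>n_as. jordan_nf (to_jnf_mat (complex_matrix M)) n_as \<and>
        (\<forall>(n, a) \<in> set n_as. cmod a = 1 \<longrightarrow> n = 1))"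

definition ideal_parameter :: "real^'m^'r \<Rightarrow> real^'m^'m \<Rightarrow> real^'m^'r" where
  "ideal_parameter B \<Lambda> =
     Finite_Cartesian_Product.transpose
       (Finite_Cartesian_Product.transpose (B ** \<Lambda>) **
        matrix_inv (B ** \<Lambda> ** \<Lambda> ** Finite_Cartesian_Product.transpose B))"

definition bounded_vec_seq :: "(nat \<Rightarrow> real^'n) \<Rightarrow> bool" where
  "bounded_vec_seq x \<longleftrightarrow> bdd_above {\<bar>x k $ i\<bar> | k i. True}"

definition bounded_mat_seq :: "(nat \<Rightarrow> real^'m^'n) \<Rightarrow> bool" where
  "bounded_mat_seq X \<longleftrightarrow> bdd_above {\<bar>X k $ i $ j\<bar> | k i j. True}"

end

theory Submission
  imports Defs "Jordan_Normal_Form.Spectral_Radius"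
begin

text \<open>
  Write \<open>T = \<theta> - \<theta>\<^sup>*\<close> and \<open>w = B \<Lambda> T\<^sup>T v\<close>; since \<open>B \<Lambda> \<theta>\<^sup>*\<^sup>T = I\<close>, we have \<open>w = - \<sigma>\<^sup>2 \<epsilon>\<close>.
  Along the update, \<open>V = tr(\<Lambda> T\<^sup>T \<Gamma>\<^sup>-\<^sup>1 T)\<close> changes by
  \<open>2 \<epsilon>\<^sup>T w + (v\<^sup>T \<Gamma> v) \<epsilon>\<^sup>T B \<Lambda> B\<^sup>T \<epsilon> \<le> - (\<sigma>\<^sup>2 + 1) |\<epsilon>|\<^sup>2\<close>. Hence \<open>\<theta>\<close> is bounded and \<open>\<epsilon>\<close> tends to 0,
  and so does \<open>w\<close> because \<open>\<sigma>\<close> is bounded. Finally \<open>e\<close> obeys a stable linear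
  recursion driven by \<open>w\<close>.
\<close>

section \<open>Transfer to the matrices of Jordan Normal Form\<close>

(* The import of Spectral_Radius brings this notation back. *)
no_notation vec_index (infixl "$" 100)
no_notation scalar_prod (infix "\<bullet>" 70)

text \<open>Entries are listed in the same order as in \<open>to_jnf_mat\<close>, so that the
  transfer commutes with matrix-vector products.\<close>

definition to_jnf_vec :: "'a^'n \<Rightarrow> 'a Matrix.vec" where
  "to_jnf_vec x = Matrix.vec CARD('n) (\<lambda>i. x $ from_nat_into (UNIV :: 'n set) i)"

lemma bij_betw_from_nat_into_card:
  "bij_betw (from_nat_into (UNIV :: 'n::finite set)) {0..<CARD('n)} UNIV"
  using bij_betw_from_nat_into_finite[of "UNIV :: 'n set"] by (simp add: lessThan_atLeast0)

lemma from_nat_into_UNIV_cases: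
  obtains i where "i < CARD('n)" and "j = from_nat_into (UNIV :: 'n::finite set) i"
proof -
  have "j \<in> from_nat_into UNIV ` {0..<CARD('n)}"
    using bij_betw_from_nat_into_card[where 'n='n] by (simp add: bij_betw_def)
  then show thesis using that by auto
qed

lemma to_jnf_vec_carrier: "to_jnf_vec (x :: 'a^'n) \<in> carrier_vec CARD('n)"
  by (simp add: to_jnf_vec_def)

lemma to_jnf_mat_carrier: "to_jnf_mat (M :: 'a^'n^'n) \<in> carrier_mat CARD('n) CARD('n)"
  by (simp add: to_jnf_mat_def)

lemma to_jnf_mult_mat_vec:
  fixes M :: "'a::field^'n^'n"
  shows "to_jnf_mat M *\<^sub>v to_jnf_vec x = to_jnf_vec (M *v x)"
proof (rule eq_vecI)
  fix i assume "i < dim_vec (to_jnf_vec (M *v x))"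
  then have i: "i < CARD('n)" by (simp add: to_jnf_vec_def)
  have "(\<Sum>j\<in>{0..<CARD('n)}. M $ from_nat_into UNIV i $ from_nat_into UNIV j * x $ from_nat_into UNIV j)
    = (\<Sum>j\<in>UNIV. M $ from_nat_into UNIV i $ j * x $ j)"
    by (rule sum.reindex_bij_betw[OF bij_betw_from_nat_into_card])
  then show "vec_index (to_jnf_mat M *\<^sub>v to_jnf_vec x) i = vec_index (to_jnf_vec (M *v x)) i"
    using i by (simp add: to_jnf_mat_def to_jnf_vec_def Matrix.scalar_prod_def matrix_vector_mult_def)
qed (simp add: to_jnf_mat_def to_jnf_vec_def)

lemma to_jnf_vec_surj:
  assumes "w \<in> carrier_vec CARD('n)"
  obtains x :: "'a^'n" where "w = to_jnf_vec x"
proof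
  let ?f = "from_nat_into (UNIV :: 'n set)"
  show "w = to_jnf_vec (\<chi> i. vec_index w (inv_into {0..<CARD('n)} ?f i) :: 'a^'n)"
    using assms bij_betw_from_nat_into_card[where 'n='n]
    by (intro eq_vecI) (auto simp: to_jnf_vec_def bij_betw_def inv_into_f_f)
qed

lemma to_jnf_vec_inject: "to_jnf_vec x = to_jnf_vec y \<longleftrightarrow> x = (y :: 'a^'n)"
proof
  assume eq: "to_jnf_vec x = to_jnf_vec y"
  show "x = y"
  proof (simp add: vec_eq_iff, rule allI)
    fix j :: 'n
    obtain i where i: "i < CARD('n)" "j = from_nat_into UNIV i"
      by (rule from_nat_into_UNIV_cases)
    from eq have "vec_index (to_jnf_vec x) i = vec_index (to_jnf_vec y) i" by simp
    then show "x $ j = y $ j" using i by (simp add: to_jnf_vec_def)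
  qed
qed simp

lemma to_jnf_vec_eq_0_iff: "to_jnf_vec x = 0\<^sub>v CARD('n) \<longleftrightarrow> x = (0 :: 'a::zero^'n)"
proof -
  have "to_jnf_vec (0 :: 'a^'n) = 0\<^sub>v CARD('n)" by (auto simp: to_jnf_vec_def)
  then show ?thesis using to_jnf_vec_inject[of x 0] by simp
qed

lemma eigenvector_to_jnf_mat_iff:
  fixes M :: "'a::field^'n^'n"
  shows "eigenvector (to_jnf_mat M) (to_jnf_vec x) \<mu> \<longleftrightarrow> x \<noteq> 0 \<and> M *v x = \<mu> *s x"
proof -
  have "\<mu> \<cdot>\<^sub>v to_jnf_vec x = to_jnf_vec (\<mu> *s x)" by (auto simp: to_jnf_vec_def)
  then show ?thesis
    using carrier_matD[OF to_jnf_mat_carrier[of M]]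
    by (simp add: eigenvector_def to_jnf_vec_carrier to_jnf_vec_eq_0_iff to_jnf_mult_mat_vec
        to_jnf_vec_inject)
qed

text \<open>Every vector of the right dimension is of the form \<open>to_jnf_vec x\<close>, so no
  eigenvector is gained or lost. This gives access to results on the spectral radius.\<close>

lemma spectrum_to_jnf_mat: "spectrum (to_jnf_mat M) = eigenvalues M"
  for M :: "'a::field^'n^'n"
proof -
  have "\<mu> \<in> eigenvalues M" if w: "eigenvector (to_jnf_mat M) w \<mu>" for w \<mu>
  proof -
    have "w \<in> carrier_vec CARD('n)"
      using w carrier_matD[OF to_jnf_mat_carrier[of M]] by (simp add: eigenvector_def)
    then obtain x :: "'a^'n" where "w = to_jnf_vec x" by (rule to_jnf_vec_surj)
    then show ?thesis using w by (auto simp: eigenvalues_def eigenvector_to_jnf_mat_iff)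
  qed
  moreover have "\<mu> \<in> spectrum (to_jnf_mat M)" if \<mu>: "\<mu> \<in> eigenvalues M" for \<mu>
  proof -
    obtain x where "x \<noteq> 0" "M *v x = \<mu> *s x" using \<mu> by (auto simp: eigenvalues_def)
    then have "eigenvector (to_jnf_mat M) (to_jnf_vec x) \<mu>"
      by (simp add: eigenvector_to_jnf_mat_iff)
    then show ?thesis unfolding spectrum_def eigenvalue_def by blast
  qed
  ultimately show ?thesis by (auto simp: spectrum_def eigenvalue_def)
qed

lemma finite_eigenvalues: "finite (eigenvalues M)" for M :: "'a::field^'n^'n"
  using card_finite_spectrum(1)[OF to_jnf_mat_carrier[of M]] by (simp add: spectrum_to_jnf_mat)

lemma to_jnf_mat_pow_mult_vec:
  fixes M :: "'a::field^'n^'n"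
  shows "(to_jnf_mat M ^\<^sub>m k) *\<^sub>v to_jnf_vec x = to_jnf_vec (((*v) M ^^ k) x)"
proof (induction k arbitrary: x)
  case 0
  then show ?case
    by (metis funpow_0 one_mult_mat_vec pow_mat.simps(1) to_jnf_mat_carrier carrier_matD(1) to_jnf_vec_carrier)
next
  case (Suc k)
  have "(to_jnf_mat M ^\<^sub>m Suc k) *\<^sub>v to_jnf_vec x
      = (to_jnf_mat M ^\<^sub>m k) *\<^sub>v (to_jnf_mat M *\<^sub>v to_jnf_vec x)"
    using assoc_mult_mat_vec[OF pow_carrier_mat[OF to_jnf_mat_carrier[of M]] to_jnf_mat_carrier[of M]
      to_jnf_vec_carrier[of x]] by simp
  then show ?case by (simp add: to_jnf_mult_mat_vec Suc.IH funpow_swap1)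
qed

text \<open>Spectral radius below 1 yields one bound \<open>c\<close> for all entries of all powers.
  Summing over the columns in each entry and then over the entries gives the factor
  \<open>?n * ?n * c\<close>.\<close>

lemma power_bounded:
  fixes M :: "complex^'n^'n"
  assumes "\<forall>\<mu> \<in> eigenvalues M. cmod \<mu> < 1"
  obtains C where "\<And>k x. norm (((*v) M ^^ k) x) \<le> C * norm x"
proof -
  let ?n = "CARD('n)" and ?A = "to_jnf_mat M"
  have "spectral_radius ?A < 1"
    using spectral_radius_mem_max(1)[OF to_jnf_mat_carrier[of M]] assms
    by (auto simp: spectrum_to_jnf_mat)
  then obtain c where c: "\<And>k. norm_bound (?A ^\<^sub>m k) c"
    using spectral_radius_jnf_norm_bound_less_1_upper_triangular[OF to_jnf_mat_carrier] by blast
  have "norm (((*v) M ^^ k) x) \<le> (?n * ?n * c) * norm x" for k x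
  proof -
    let ?f = "from_nat_into (UNIV :: 'n set)"
    let ?y = "((*v) M ^^ k) x"
    have carr: "?A ^\<^sub>m k \<in> carrier_mat ?n ?n" using pow_carrier_mat[OF to_jnf_mat_carrier[of M]] .
    have entry: "cmod (?y $ ?f i) \<le> ?n * c * norm x" if i: "i < ?n" for i
    proof -
      have "?y $ ?f i = vec_index (to_jnf_vec ?y) i" using i by (simp add: to_jnf_vec_def)
      also have "\<dots> = vec_index ((?A ^\<^sub>m k) *\<^sub>v to_jnf_vec x) i" by (simp add: to_jnf_mat_pow_mult_vec)
      also have "\<dots> = (\<Sum>j\<in>{0..<?n}. (?A ^\<^sub>m k) $$ (i, j) * x $ ?f j)"
        using i carr carrier_matD[OF to_jnf_mat_carrier[of M]]
        by (simp add: Matrix.scalar_prod_def to_jnf_vec_def)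
      also have "cmod \<dots> \<le> (\<Sum>j\<in>{0..<?n}. c * norm x)"
      proof (rule order_trans[OF norm_sum], rule sum_mono, unfold norm_mult)
        fix j assume "j \<in> {0..<?n}"
        then have "cmod ((?A ^\<^sub>m k) $$ (i, j)) \<le> c"
          using c[of k] i carr unfolding norm_bound_def carrier_matD[OF carr] by simp
        then show "cmod ((?A ^\<^sub>m k) $$ (i, j)) * cmod (x $ ?f j) \<le> c * norm x"
          using order_trans[OF norm_ge_zero] by (intro mult_mono Finite_Cartesian_Product.norm_nth_le) auto
      qed
      finally show ?thesis by simp
    qed
    have "norm ?y \<le> (\<Sum>i\<in>UNIV. cmod (?y $ i))"
      by (simp add: norm_vec_def L2_set_le_sum)
    also have "\<dots> \<le> (\<Sum>i\<in>(UNIV :: 'n set). ?n * c * norm x)"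
    proof (rule sum_mono)
      fix j :: 'n
      obtain i where "i < ?n" "j = ?f i"
        by (rule from_nat_into_UNIV_cases)
      then show "cmod (?y $ j) \<le> ?n * c * norm x" using entry by simp
    qed
    finally show ?thesis by (simp add: mult.assoc)
  qed
  then show thesis by (rule that)
qed

section \<open>Stable linear recursions\<close>

definition complex_vector :: "real^'n \<Rightarrow> complex^'n" where
  "complex_vector x = (\<chi> i. complex_of_real (x $ i))"

lemma norm_complex_vector: "norm (complex_vector x) = norm x"
  by (simp add: complex_vector_def norm_vec_def L2_set_def)

lemma complex_matrix_mult_complex_vector:
  "complex_matrix A *v complex_vector x = complex_vector (A *v x)"
  by (simp add: vec_eq_iff complex_vector_def matrix_vector_mult_def map_matrix_def)

lemma power_complex_matrix_mult:
  fixes A :: "real^'n^'n"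
  shows "((*v) (complex_matrix A) ^^ k) (complex_vector x) = complex_vector (((*v) A ^^ k) x)"
  by (induction k) (simp_all add: complex_matrix_mult_complex_vector)

lemma power_scaleR_mult_vec:
  fixes A :: "real^'n^'n"
  shows "((*v) (c *\<^sub>R A) ^^ k) x = c ^ k *\<^sub>R ((*v) A ^^ k) x"
  by (induction k) (simp_all add: scaleR_matrix_vector_assoc[symmetric] matrix_scaleR_vector_ac)

text \<open>Since there are finitely many eigenvalues, some \<rho> < 1 exceeds all their moduli.
  Dividing the matrix by \<rho> keeps its eigenvalues inside the unit circle, so
  \<open>power_bounded\<close> applied to the quotient gives geometric decay of the original
  powers.\<close>

lemma stable_power_bound:
  fixes A :: "real^'n^'n"
  assumes "\<forall>\<mu> \<in> eigenvalues (complex_matrix A). cmod \<mu> < 1"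
  obtains \<rho> C where "0 < \<rho>" "\<rho> < 1" "\<forall>k x. norm (((*v) A ^^ k) x) / \<rho> ^ k \<le> C * norm x"
proof -
  \<comment> \<open>Midpoint between 1 and the largest modulus. The inserted 0 makes
    \<open>Max\<close> nonnegative, hence \<rho> positive.\<close>
  define \<rho> where "\<rho> = (1 + Max (insert 0 (cmod ` eigenvalues (complex_matrix A)))) / 2"
  let ?S = "insert 0 (cmod ` eigenvalues (complex_matrix A))"
  have fin: "finite ?S" by (simp add: finite_eigenvalues)
  have lt1: "Max ?S < 1" using fin assms by (subst Max_less_iff) auto
  have ge0: "0 \<le> Max ?S" using fin by (intro Max_ge) auto
  have \<rho>: "0 < \<rho>" "\<rho> < 1" "Max ?S < \<rho>" using lt1 ge0 by (simp_all add: \<rho>_def)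
  have below: "cmod \<mu> < \<rho>" if "\<mu> \<in> eigenvalues (complex_matrix A)" for \<mu>
    using Max_ge[OF fin, of "cmod \<mu>"] that \<rho>(3) by auto
  let ?M = "complex_matrix ((1 / \<rho>) *\<^sub>R A)"
  have "\<forall>\<mu> \<in> eigenvalues ?M. cmod \<mu> < 1"
  proof
    fix \<mu> assume "\<mu> \<in> eigenvalues ?M"
    then obtain x where x: "x \<noteq> 0" "?M *v x = \<mu> *s x" by (auto simp: eigenvalues_def)
    \<comment> \<open>An eigenvector of the rescaled matrix for \<mu> is one of \<open>A\<close> for
      \<rho> times \<mu>, whose modulus is below \<rho>.\<close>
    have "complex_matrix A *v x = complex_of_real \<rho> *s (?M *v x)"
      using \<rho>(1) by (simp add: vec_eq_iff matrix_vector_mult_def map_matrix_def sum_distrib_left field_simps)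
    then have "complex_of_real \<rho> * \<mu> \<in> eigenvalues (complex_matrix A)"
      using x by (auto simp: eigenvalues_def vector_smult_assoc)
    from below[OF this] show "cmod \<mu> < 1" using \<rho>(1) by (simp add: norm_mult)
  qed
  then obtain C where C: "\<And>k x. norm (((*v) ?M ^^ k) x) \<le> C * norm x" using power_bounded by blast
  have "norm (((*v) A ^^ k) x) / \<rho> ^ k \<le> C * norm x" for k x
    using C[of k "complex_vector x"] \<rho>(1)
    by (simp add: power_complex_matrix_mult norm_complex_vector power_scaleR_mult_vec power_one_over field_simps)
  then show thesis using that \<rho> by blast
qed

text \<open>Once the input stays below \<open>(1 - \<rho>) * (r / 2)\<close>, the level
  \<open>r / 2\<close> is invariant, because
  \<open>\<rho> * (r / 2) + (1 - \<rho>) * (r / 2) = r / 2\<close>. The excess over this level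
  decays geometrically.\<close>

lemma contraction_recursion_tendsto_0:
  fixes a b :: "nat \<Rightarrow> real"
  assumes step: "\<And>k. a (Suc k) \<le> \<rho> * a k + b k" and nonneg: "\<And>k. 0 \<le> a k"
    and \<rho>: "0 < \<rho>" "\<rho> < 1" and b: "b \<longlonglongrightarrow> 0"
  shows "a \<longlonglongrightarrow> 0"
proof (rule LIMSEQ_I)
  fix r :: real assume "0 < r"
  then have "0 < (1 - \<rho>) * (r / 2)" using \<rho> by simp
  from LIMSEQ_D[OF b this] obtain K where K: "\<And>k. k \<ge> K \<Longrightarrow> \<bar>b k\<bar> < (1 - \<rho>) * (r / 2)" by auto
  have shifted: "a (K + n) \<le> \<rho> ^ n * a K + r / 2" for n
  proof (induction n)
    case 0 then show ?case using \<open>0 < r\<close> by simp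
  next
    case (Suc n)
    have "a (K + Suc n) \<le> \<rho> * a (K + n) + b (K + n)" using step by simp
    also have "\<dots> \<le> \<rho> * (\<rho> ^ n * a K + r / 2) + (1 - \<rho>) * (r / 2)"
      using mult_left_mono[OF Suc.IH, of \<rho>] K[of "K + n"] \<rho> by linarith
    also have "\<dots> = \<rho> ^ Suc n * a K + r / 2" by (simp add: field_simps)
    finally show ?case .
  qed
  have "(\<lambda>n. \<rho> ^ n * a K) \<longlonglongrightarrow> 0" using \<rho> by (intro tendsto_mult_left_zero LIMSEQ_realpow_zero) auto
  from LIMSEQ_D[OF this, of "r / 2"] \<open>0 < r\<close> obtain L where L: "\<And>n. n \<ge> L \<Longrightarrow> \<bar>\<rho> ^ n * a K\<bar> < r / 2" by auto
  show "\<exists>no. \<forall>n\<ge>no. norm (a n - 0) < r"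
  proof (intro exI allI impI)
    fix n assume n: "K + L \<le> n"
    then have "a n \<le> \<rho> ^ (n - K) * a K + r / 2" using shifted[of "n - K"] by simp
    moreover have "\<rho> ^ (n - K) * a K < r / 2" using L[of "n - K"] n by linarith
    ultimately show "norm (a n - 0) < r" using nonneg[of n] by simp
  qed
qed

text \<open>Measured in an adapted norm \<open>N\<close>, the vector recursion becomes a scalar
  contraction with input \<open>C * norm (w k)\<close>; since \<open>N\<close> dominates the usual
  norm, the limit carries over.\<close>

lemma stable_recursion_tendsto_0:
  fixes A :: "real^'n^'n"
  assumes stable: "\<forall>\<mu> \<in> eigenvalues (complex_matrix A). cmod \<mu> < 1"
    and step: "\<And>k. x (Suc k) = A *v x k + w k" and w: "w \<longlonglongrightarrow> 0"
  shows "x \<longlonglongrightarrow> 0"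
proof -
  obtain \<rho> C where \<rho>: "0 < \<rho>" "\<rho> < 1"
    and "\<forall>k x. norm (((*v) A ^^ k) x) / \<rho> ^ k \<le> C * norm x" by (rule stable_power_bound[OF stable])
  then have C: "norm (((*v) A ^^ k) x) / \<rho> ^ k \<le> C * norm x" for k x by blast
  \<comment> \<open>An equivalent norm in which multiplication by \<open>A\<close> is a contraction.\<close>
  define N where "N x = (SUP k. norm (((*v) A ^^ k) x) / \<rho> ^ k)" for x
  have bdd: "bdd_above (range (\<lambda>k. norm (((*v) A ^^ k) x) / \<rho> ^ k))" for x
    using C by (intro bdd_aboveI2)
  have N_ge: "norm (((*v) A ^^ k) x) / \<rho> ^ k \<le> N x" for k x
    unfolding N_def by (rule cSUP_upper[OF UNIV_I bdd])
  have N_le: "N x \<le> C * norm x" for x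
    unfolding N_def using C by (intro cSUP_least) auto
  have norm_le_N: "norm x \<le> N x" for x using N_ge[of 0 x] by simp
  have N_add: "N (x + y) \<le> N x + N y" for x y
  proof -
    have lin: "((*v) A ^^ k) (x + y) = ((*v) A ^^ k) x + ((*v) A ^^ k) y" for k
      by (induction k) (simp_all add: matrix_vector_right_distrib)
    have "norm (((*v) A ^^ k) (x + y)) / \<rho> ^ k \<le> N x + N y" for k
    proof -
      have "norm (((*v) A ^^ k) (x + y)) / \<rho> ^ k
          \<le> norm (((*v) A ^^ k) x) / \<rho> ^ k + norm (((*v) A ^^ k) y) / \<rho> ^ k"
        using \<rho>(1) by (simp add: lin norm_triangle_ineq divide_right_mono flip: add_divide_distrib)
      then show ?thesis using N_ge[of k x] N_ge[of k y] by linarith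
    qed
    then show ?thesis unfolding N_def[of "x + y"] by (intro cSUP_least) auto
  qed
  \<comment> \<open>Applying \<open>A\<close> first shifts the index of the supremum by one, and the
    denominator \<open>\<rho> ^ k\<close> then lacks one factor \<rho>.\<close>
  have N_mult: "N (A *v x) \<le> \<rho> * N x" for x
  proof -
    have "norm (((*v) A ^^ k) (A *v x)) / \<rho> ^ k \<le> \<rho> * N x" for k
      using N_ge[of "Suc k" x] \<rho>(1) by (simp add: funpow_swap1 field_simps)
    then show ?thesis unfolding N_def[of "A *v x"] by (intro cSUP_least) auto
  qed
  have N_step: "N (x (Suc k)) \<le> \<rho> * N (x k) + C * norm (w k)" for k
    using N_add[of "A *v x k" "w k"] N_mult[of "x k"] N_le[of "w k"] by (simp add: step)
  have N_nonneg: "0 \<le> N (x k)" for k using norm_le_N[of "x k"] norm_ge_zero[of "x k"] by linarith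
  have "(\<lambda>k. C * norm (w k)) \<longlonglongrightarrow> 0"
    using tendsto_norm_zero[OF w] by (rule tendsto_mult_right_zero)
  then have "(\<lambda>k. N (x k)) \<longlonglongrightarrow> 0"
    using contraction_recursion_tendsto_0[where a = "\<lambda>k. N (x k)" and b = "\<lambda>k. C * norm (w k)",
      OF N_step N_nonneg \<rho>] by simp
  then show ?thesis
    by (rule Lim_null_comparison[rotated]) (simp add: norm_le_N)
qed

section \<open>Symmetric matrices and the ideal parameter\<close>

abbreviation (input) mat_transpose :: "'a^'m^'n \<Rightarrow> 'a^'n^'m" where
  "mat_transpose \<equiv> Finite_Cartesian_Product.transpose"

lemma inner_matrix_mult_transpose: "x \<bullet> (A *v y) = (mat_transpose A *v x) \<bullet> y"
  for A :: "real^'m^'n"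
  by (simp add: dot_lmul_matrix transpose_matrix_vector)

text \<open>Near \<open>t = 0\<close> the linear term dominates, so it cannot change sign. This
  serves as the first-order condition at a maximiser, without derivatives.\<close>

lemma nonneg_quadratic_imp_linear_coeff_0:
  fixes b c :: real
  assumes "\<And>t. 0 \<le> 2 * t * b + t\<^sup>2 * c"
  shows "b = 0"
proof (rule ccontr)
  assume "b \<noteq> 0"
  \<comment> \<open>The added 1 keeps \<open>d\<close> positive even for \<open>c = 0\<close>; at
    \<open>t = - b / d\<close> the quadratic is then at most
    \<open>- (b\<^sup>2 / d)\<close>.\<close>
  define d where "d = \<bar>c\<bar> + 1"
  then have "0 < d" by simp
  have "0 \<le> 2 * (- b / d) * b + (- b / d)\<^sup>2 * c" by (rule assms)
  also have "\<dots> \<le> 2 * (- b / d) * b + (- b / d)\<^sup>2 * d"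
    by (intro add_left_mono mult_left_mono) (auto simp: d_def)
  also have "\<dots> = - (b\<^sup>2 / d)" using \<open>0 < d\<close> by (simp add: power2_eq_square field_simps)
  also have "\<dots> < 0" using \<open>b \<noteq> 0\<close> \<open>0 < d\<close> by simp
  finally show False by simp
qed

text \<open>The quadratic form attains its maximum \<mu> over the compact unit sphere at some
  \<open>z\<close>. The difference of \<mu> times the squared norm and the form is nonnegative and
  vanishes at \<open>z\<close>, so its first variation there is zero in every direction, which says
  that \<open>z\<close> is an eigenvector.\<close>

lemma rayleigh_max_eigenvalue:
  fixes S :: "real^'n^'n"
  assumes sym: "mat_transpose S = S"
  obtains \<mu> where "\<mu> \<in> eigenvalues S" and "\<And>x. x \<bullet> (S *v x) \<le> \<mu> * (norm x)\<^sup>2"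
proof -
  have cont: "continuous_on (sphere 0 1) (\<lambda>x::real^'n. x \<bullet> (S *v x))"
    by (intro continuous_intros linear_continuous_on matrix_vector_mul_bounded_linear)
  have ne: "sphere (0 :: real^'n) 1 \<noteq> {}" by simp
  obtain z where z: "z \<in> sphere 0 1"
    and max: "\<And>x. x \<in> sphere 0 1 \<Longrightarrow> x \<bullet> (S *v x) \<le> z \<bullet> (S *v z)"
    using continuous_attains_sup[OF compact_sphere ne cont] by blast
  define \<mu> where "\<mu> = z \<bullet> (S *v z)"
  have bound: "x \<bullet> (S *v x) \<le> \<mu> * (norm x)\<^sup>2" for x
  proof (cases "x = 0")
    case False
    have "(x /\<^sub>R norm x) \<bullet> (S *v (x /\<^sub>R norm x)) \<le> \<mu>"
      unfolding \<mu>_def using False by (intro max) simp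
    then show ?thesis
      using False by (simp add: matrix_scaleR_vector_ac scaleR_matrix_vector_assoc[symmetric] power2_eq_square field_simps)
  qed simp
  have "y \<bullet> (\<mu> *\<^sub>R z - S *v z) = 0" for y
  proof (rule nonneg_quadratic_imp_linear_coeff_0)
    fix t :: real
    have zz: "z \<bullet> z = 1" using z by (simp add: dot_square_norm)
    have yz: "z \<bullet> (S *v y) = y \<bullet> (S *v z)"
      by (simp add: inner_matrix_mult_transpose[of z S y] sym inner_commute)
    have le: "(z + t *\<^sub>R y) \<bullet> (S *v (z + t *\<^sub>R y)) \<le> \<mu> * ((z + t *\<^sub>R y) \<bullet> (z + t *\<^sub>R y))"
      using bound[of "z + t *\<^sub>R y"] by (simp add: dot_square_norm)
    have lhs: "(z + t *\<^sub>R y) \<bullet> (S *v (z + t *\<^sub>R y))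
        = \<mu> + 2 * t * (y \<bullet> (S *v z)) + t\<^sup>2 * (y \<bullet> (S *v y))"
      by (simp add: matrix_vector_right_distrib matrix_scaleR_vector_ac scaleR_matrix_vector_assoc[symmetric]
          inner_add_left inner_add_right yz \<mu>_def power2_eq_square algebra_simps)
    have rhs: "(z + t *\<^sub>R y) \<bullet> (z + t *\<^sub>R y) = 1 + 2 * t * (y \<bullet> z) + t\<^sup>2 * (y \<bullet> y)"
      by (simp add: inner_add_left inner_add_right zz inner_commute[of z y] power2_eq_square algebra_simps)
    show "0 \<le> 2 * t * (y \<bullet> (\<mu> *\<^sub>R z - S *v z)) + t\<^sup>2 * (\<mu> * (y \<bullet> y) - y \<bullet> (S *v y))"
      using le unfolding lhs rhs by (simp add: inner_diff_right algebra_simps)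
  qed
  from this[of "\<mu> *\<^sub>R z - S *v z"] have "\<mu> *\<^sub>R z - S *v z = 0" by simp
  moreover have "z \<noteq> 0" using z by auto
  ultimately have "\<mu> \<in> eigenvalues S" by (auto simp: eigenvalues_def scalar_mult_eq_scaleR)
  then show thesis using that bound by blast
qed

lemma quadratic_form_le_lambda_max:
  fixes S :: "real^'n^'n"
  assumes "mat_transpose S = S"
  shows "x \<bullet> (S *v x) \<le> lambda_max S * (norm x)\<^sup>2"
proof -
  obtain \<mu> where \<mu>: "\<mu> \<in> eigenvalues S" "\<And>x. x \<bullet> (S *v x) \<le> \<mu> * (norm x)\<^sup>2"
    using rayleigh_max_eigenvalue[OF assms] by blast
  have "\<mu> \<le> lambda_max S" unfolding lambda_max_def using finite_eigenvalues \<mu>(1) by (rule Max_ge)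
  then show ?thesis using \<mu>(2)[of x] by (meson mult_right_mono order_trans zero_le_power2)
qed

text \<open>The Rayleigh bound is applied to \<open>- P\<close>: its maximal eigenvalue is negative,
  since \<open>P\<close> is positive on the eigenvector, and its negation serves as
  \<open>p\<close>.\<close>

lemma pos_def_lower_bound:
  fixes P :: "real^'n^'n"
  assumes "mat_transpose P = P" and pos: "\<And>x. x \<noteq> 0 \<Longrightarrow> 0 < x \<bullet> (P *v x)"
  obtains p where "0 < p" and "\<And>x. p * (norm x)\<^sup>2 \<le> x \<bullet> (P *v x)"
proof -
  have neg: "(- P) *v x = - (P *v x)" for x
    by (simp add: vec_eq_iff matrix_vector_mult_def sum_negf)
  have "mat_transpose (- P) = - P" using assms(1) by (simp add: vec_eq_iff Finite_Cartesian_Product.transpose_def)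
  then obtain \<mu> where \<mu>: "\<mu> \<in> eigenvalues (- P)" "\<And>x. x \<bullet> ((- P) *v x) \<le> \<mu> * (norm x)\<^sup>2"
    using rayleigh_max_eigenvalue by blast
  obtain z where z: "z \<noteq> 0" "(- P) *v z = \<mu> *s z" using \<mu>(1) by (auto simp: eigenvalues_def)
  have "z \<bullet> (P *v z) = - \<mu> * (z \<bullet> z)"
    using arg_cong[OF z(2), of "inner z"] by (simp add: neg scalar_mult_eq_scaleR)
  then have "0 < - \<mu> * (z \<bullet> z)" using pos[OF z(1)] by simp
  then have "0 < - \<mu>" by (rule zero_less_mult_pos2) (simp add: z(1))
  moreover have "- \<mu> * (norm x)\<^sup>2 \<le> x \<bullet> (P *v x)" for x using \<mu>(2)[of x] by (simp add: neg)
  ultimately show thesis by (rule that)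
qed

lemma matrix_inv_right_inverse:
  fixes A :: "real^'n^'n"
  assumes "\<And>x. A *v x = 0 \<Longrightarrow> x = 0"
  shows "A ** matrix_inv A = mat 1"
proof -
  have "\<exists>B. B ** A = mat 1" using assms matrix_left_invertible_ker by blast
  then have "invertible A" by (simp add: invertible_left_inverse)
  then show ?thesis unfolding invertible_def matrix_inv_def by (rule someI2_ex) auto
qed

text \<open>Supplies the inverse gain that weights the Lyapunov function. Transposing
  \<open>G ** P = mat 1\<close> shows that the transpose of \<open>P\<close> is also an inverse of
  \<open>G\<close>, hence equal to \<open>P\<close>; positivity follows by evaluating the form of
  \<open>G\<close> at \<open>P *v x\<close>.\<close>

lemma pos_def_inverse:
  fixes G :: "real^'n^'n"
  assumes sym: "mat_transpose G = G" and pos: "\<And>x. x \<noteq> 0 \<Longrightarrow> 0 < x \<bullet> (G *v x)"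
  obtains P where "mat_transpose P = P" and "\<And>x. x \<noteq> 0 \<Longrightarrow> 0 < x \<bullet> (P *v x)" and "\<And>x. P *v (G *v x) = x"
proof -
  define P where "P = matrix_inv G"
  have "x = 0" if "G *v x = 0" for x using pos[of x] that by auto
  then have GP: "G ** P = mat 1" unfolding P_def by (rule matrix_inv_right_inverse)
  then have PG: "P ** G = mat 1" by (rule matrix_left_right_inverse1)
  have G_P: "G *v (P *v x) = x" and P_G: "P *v (G *v x) = x" for x
    by (simp_all add: matrix_vector_mul_assoc GP PG)
  have "mat_transpose P ** G = mat 1"
    using arg_cong[OF GP, of mat_transpose] by (simp add: matrix_transpose_mul sym)
  then have "mat_transpose P = P" by (metis GP matrix_mul_assoc matrix_mul_lid matrix_mul_rid)
  moreover have "0 < x \<bullet> (P *v x)" if "x \<noteq> 0" for x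
  proof -
    have "P *v x \<noteq> 0" using that G_P[of x] by auto
    from pos[OF this] show ?thesis by (simp add: G_P inner_commute)
  qed
  ultimately show thesis using that P_G by blast
qed

lemma diagonal_mult_vec:
  fixes L :: "real^'m^'m"
  assumes "\<And>i j. i \<noteq> j \<Longrightarrow> L $ i $ j = 0"
  shows "(L *v x) $ i = L $ i $ i * x $ i"
  using assms by (simp add: matrix_vector_mult_def sum.remove[of UNIV i])

lemma diagonal_symmetric:
  assumes "\<And>i j. i \<noteq> j \<Longrightarrow> L $ i $ j = 0"
  shows "mat_transpose L = L"
  by (simp add: vec_eq_iff Finite_Cartesian_Product.transpose_def) (metis assms)

text \<open>The quadratic form of the Gram matrix of \<open>B ** L\<close> is the squared norm of
  \<open>L *v (mat_transpose B *v x)\<close>. Full row rank and a nonzero diagonal make it vanish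
  only at 0, so the inverse in \<open>ideal_parameter\<close> is a true one.\<close>

lemma ideal_parameter_right_inverse:
  fixes B :: "real^'m^'r" and L :: "real^'m^'m"
  assumes rank_B: "rank B = CARD('r)"
    and diag: "\<And>i j. i \<noteq> j \<Longrightarrow> L $ i $ j = 0" and nonzero: "\<And>i. L $ i $ i \<noteq> 0"
  shows "B ** L ** mat_transpose (ideal_parameter B L) = mat 1"
proof -
  have L_sym: "mat_transpose L = L" using diag by (rule diagonal_symmetric)
  have L_mult: "(L *v x) $ i = L $ i $ i * x $ i" for x i using diag by (rule diagonal_mult_vec)
  have "x = 0" if x: "(B ** L ** L ** mat_transpose B) *v x = 0" for x
  proof -
    have "(L *v (mat_transpose B *v x)) \<bullet> (L *v (mat_transpose B *v x)) = x \<bullet> ((B ** L ** L ** mat_transpose B) *v x)"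
      by (simp add: inner_matrix_mult_transpose L_sym flip: matrix_vector_mul_assoc)
    then have "L *v (mat_transpose B *v x) = 0" using x by simp
    then have "mat_transpose B *v x = 0" using L_mult nonzero by (auto simp: vec_eq_iff)
    moreover have "inj ((*v) (mat_transpose B))" using rank_B rank_transpose[of B] full_rank_injective by metis
    ultimately show ?thesis using injD[of "(*v) (mat_transpose B)" x 0] by simp
  qed
  then have "B ** L ** L ** mat_transpose B ** matrix_inv (B ** L ** L ** mat_transpose B) = mat 1"
    by (rule matrix_inv_right_inverse)
  then show ?thesis
    by (simp add: ideal_parameter_def matrix_transpose_mul L_sym matrix_mul_assoc)
qed

section \<open>The Lyapunov function\<close>

lemma bounded_vec_seqI: "(\<And>k i. \<bar>x k $ i\<bar> \<le> K) \<Longrightarrow> bounded_vec_seq x"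
  unfolding bounded_vec_seq_def by (rule bdd_aboveI[of _ K]) auto

lemma bounded_vec_seqE:
  assumes "bounded_vec_seq x"
  obtains K where "\<forall>k i. \<bar>x k $ i\<bar> \<le> K"
  using assms unfolding bounded_vec_seq_def bdd_above_def by blast

lemma bounded_mat_seqI: "(\<And>k i j. \<bar>X k $ i $ j\<bar> \<le> K) \<Longrightarrow> bounded_mat_seq X"
  unfolding bounded_mat_seq_def by (rule bdd_aboveI[of _ K]) auto

lemma bounded_vec_seq_norm:
  assumes "bounded_vec_seq (x :: nat \<Rightarrow> real^'n)"
  obtains K where "\<forall>k. norm (x k) \<le> K"
proof -
  obtain K where K: "\<forall>k i. \<bar>x k $ i\<bar> \<le> K" using assms by (rule bounded_vec_seqE)
  have "norm (x k) \<le> (\<Sum>i\<in>(UNIV :: 'n set). K)" for k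
    using norm_le_l1_cart[of "x k"] K by (meson order_trans sum_mono)
  then show thesis using that by blast
qed

lemma tendsto_imp_bounded_vec_seq:
  assumes "x \<longlonglongrightarrow> l"
  shows "bounded_vec_seq x"
proof -
  have "Bseq x" using assms convergentI convergent_imp_Bseq by blast
  then obtain K where "\<And>k. norm (x k) \<le> K" by (auto simp: Bseq_def)
  then show ?thesis
    by (intro bounded_vec_seqI[of _ K]) (meson component_le_norm_cart order_trans)
qed

text \<open>For diagonal \<open>L\<close> this is the trace of \<open>L X\<^sup>T P X\<close>. It is
  written by columns because the parameter update moves every column along the same vector.\<close>

definition lyapunov :: "real^'m^'m \<Rightarrow> real^'r^'r \<Rightarrow> real^'m^'r \<Rightarrow> real" where
  "lyapunov L P X = (\<Sum>j\<in>UNIV. L $ j $ j * (column j X \<bullet> (P *v column j X)))"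

text \<open>With \<open>b = mat_transpose B *v \<epsilon>\<close>, column \<open>j\<close> moves by
  \<open>b $ j *\<^sub>R (G *v v)\<close>. As \<open>P\<close> cancels \<open>G\<close>, each square
  can be expanded without any inverse left in the increment; the weighted sums over \<open>j\<close>
  reassemble into the two forms in \<epsilon>.\<close>

lemma lyapunov_update:
  fixes B X :: "real^'m^'r" and L :: "real^'m^'m" and G P :: "real^'r^'r" and v \<epsilon> :: "real^'r"
  assumes diag: "\<And>i j. i \<noteq> j \<Longrightarrow> L $ i $ j = 0"
    and P_sym: "mat_transpose P = P" and PG: "\<And>x. P *v (G *v x) = x"
  shows "lyapunov L P (X + G ** (columnvector v :: real^1^'r) ** rowvector \<epsilon> ** B)
    = lyapunov L P X + 2 * (\<epsilon> \<bullet> ((B ** L) *v (mat_transpose X *v v)))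
      + (v \<bullet> (G *v v)) * (\<epsilon> \<bullet> ((B ** L ** mat_transpose B) *v \<epsilon>))"
proof -
  define b where "b = mat_transpose B *v \<epsilon>"
  have col: "column j (X + G ** (columnvector v :: real^1^'r) ** rowvector \<epsilon> ** B)
      = column j X + b $ j *\<^sub>R (G *v v)" for j
    by (simp add: vec_eq_iff column_def b_def matrix_matrix_mult_def matrix_vector_mult_def
        columnvector_def rowvector_def Finite_Cartesian_Product.transpose_def sum_distrib_left
        sum_distrib_right mult.assoc mult.commute mult.left_commute)
      (intro allI sum.swap)
  have square: "(c + s *\<^sub>R (G *v v)) \<bullet> (P *v (c + s *\<^sub>R (G *v v)))
      = c \<bullet> (P *v c) + 2 * s * (v \<bullet> c) + s\<^sup>2 * (v \<bullet> (G *v v))" for c s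
  proof -
    have "(G *v v) \<bullet> (P *v c) = v \<bullet> c"
      by (simp add: inner_matrix_mult_transpose[of _ P] P_sym PG)
    then show ?thesis
      by (simp add: matrix_vector_right_distrib matrix_scaleR_vector_ac scaleR_matrix_vector_assoc[symmetric]
          PG inner_add_left inner_add_right inner_commute[of c v] inner_commute[of "G *v v" v]
          power2_eq_square algebra_simps)
  qed
  have cross: "(\<Sum>j\<in>UNIV. L $ j $ j * (b $ j * (v \<bullet> column j X)))
      = \<epsilon> \<bullet> ((B ** L) *v (mat_transpose X *v v))"
  proof -
    have "\<epsilon> \<bullet> ((B ** L) *v (mat_transpose X *v v)) = b \<bullet> (L *v (mat_transpose X *v v))"
      by (simp add: b_def inner_matrix_mult_transpose[of \<epsilon> B] flip: matrix_vector_mul_assoc)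
    also have "\<dots> = (\<Sum>j\<in>UNIV. L $ j $ j * (b $ j * (mat_transpose X *v v) $ j))"
      by (simp add: inner_vec_def[of b] diagonal_mult_vec[OF diag] mult.left_commute)
    also have "(\<lambda>j. (mat_transpose X *v v) $ j) = (\<lambda>j. v \<bullet> column j X)"
      by (simp add: inner_vec_def matrix_vector_mult_def column_def
          Finite_Cartesian_Product.transpose_def mult.commute del: transpose_matrix_vector)
    finally show ?thesis by simp
  qed
  have quad: "(\<Sum>j\<in>UNIV. L $ j $ j * (b $ j)\<^sup>2) = \<epsilon> \<bullet> ((B ** L ** mat_transpose B) *v \<epsilon>)"
  proof -
    have "\<epsilon> \<bullet> ((B ** L ** mat_transpose B) *v \<epsilon>) = b \<bullet> (L *v b)"
      by (simp add: b_def inner_matrix_mult_transpose[of \<epsilon> B] flip: matrix_vector_mul_assoc)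
    also have "\<dots> = (\<Sum>j\<in>UNIV. L $ j $ j * (b $ j)\<^sup>2)"
      by (simp add: inner_vec_def diagonal_mult_vec[OF diag] power2_eq_square mult.commute mult.left_commute)
    finally show ?thesis by simp
  qed
  have "lyapunov L P (X + G ** (columnvector v :: real^1^'r) ** rowvector \<epsilon> ** B)
    = lyapunov L P X + 2 * (\<Sum>j\<in>UNIV. L $ j $ j * (b $ j * (v \<bullet> column j X)))
      + (v \<bullet> (G *v v)) * (\<Sum>j\<in>UNIV. L $ j $ j * (b $ j)\<^sup>2)"
    unfolding lyapunov_def col square
    by (simp add: sum.distrib sum_distrib_left algebra_simps)
  then show ?thesis by (simp only: cross quad)
qed

text \<open>All summands are nonnegative, so one of them, and within it one squared entry, is
  controlled by the whole. This turns a bound on the Lyapunov function into entrywise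
  bounds.\<close>

lemma lyapunov_lower_bound:
  fixes X :: "real^'m^'r"
  assumes pos: "\<And>i. 0 < L $ i $ i" and p: "0 < p" "\<And>x. p * (norm x)\<^sup>2 \<le> x \<bullet> (P *v x)"
  shows "L $ j $ j * p * (X $ i $ j)\<^sup>2 \<le> lyapunov L P X"
proof -
  have form_nonneg: "0 \<le> x \<bullet> (P *v x)" for x
    using p(1) p(2)[of x] by (meson order_trans less_imp_le mult_nonneg_nonneg zero_le_power2)
  have "(X $ i $ j)\<^sup>2 \<le> (norm (column j X))\<^sup>2"
    using component_le_norm_cart[of "column j X" i] by (simp add: column_def abs_le_square_iff[symmetric])
  then have "p * (X $ i $ j)\<^sup>2 \<le> column j X \<bullet> (P *v column j X)"
    using p by (meson less_imp_le mult_left_mono order_trans)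
  then have "L $ j $ j * p * (X $ i $ j)\<^sup>2 \<le> L $ j $ j * (column j X \<bullet> (P *v column j X))"
    using pos[of j] by (simp add: mult.assoc)
  also have "\<dots> \<le> lyapunov L P X"
    unfolding lyapunov_def using form_nonneg pos
    by (intro member_le_sum) (auto simp: less_imp_le)
  finally show ?thesis .
qed

text \<open>A decreasing sequence bounded below converges, so its successive differences, which
  dominate the squares, tend to 0.\<close>

lemma telescoping_squares_tendsto_0:
  fixes V :: "nat \<Rightarrow> real"
  assumes step: "\<And>k. V (Suc k) \<le> V k - (a k)\<^sup>2" and nonneg: "\<And>k. 0 \<le> V k"
  shows "a \<longlonglongrightarrow> 0"
proof -
  have "V (Suc k) \<le> V k" for k using step[of k] zero_le_power2[of "a k"] by linarith
  then have "decseq V" by (rule decseq_SucI)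
  then obtain l where l: "V \<longlonglongrightarrow> l" using decseq_convergent nonneg by blast
  have "(\<lambda>k. V k - V (Suc k)) \<longlonglongrightarrow> l - l" using l LIMSEQ_Suc[OF l] by (rule tendsto_diff)
  then have "(\<lambda>k. (a k)\<^sup>2) \<longlonglongrightarrow> 0"
    by (intro tendsto_sandwich[of "\<lambda>k. 0" "\<lambda>k. (a k)\<^sup>2" sequentially "\<lambda>k. V k - V (Suc k)"])
      (use step in \<open>auto simp: algebra_simps\<close>)
  then show ?thesis by (simp add: tendsto_null_power)
qed

section \<open>Boundedness and convergence of the adaptive scheme\<close>

theorem theorem2:
  fixes B :: "real^'m^'r"
    and \<Lambda> :: "real^'m^'m"
    and A\<^sub>m \<Gamma> :: "real^'r^'r"
    and v \<xi> \<xi>\<^sub>m e \<epsilon> :: "nat \<Rightarrow> real^'r"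
    and u :: "nat \<Rightarrow> real^'m"
    and \<theta> :: "nat \<Rightarrow> real^'m^'r"
    and \<sigma> :: "nat \<Rightarrow> real"
  assumes r_less_m: "CARD('r) < CARD('m)"
    and rank_B: "rank B = CARD('r)"
    and \<Lambda>_diagonal: "\<And>i j. i \<noteq> j \<Longrightarrow> \<Lambda> $ i $ j = 0"
    and \<Lambda>_entries: "\<And>i. 0 < \<Lambda> $ i $ i \<and> \<Lambda> $ i $ i \<le> 1"
    and v_bounded: "bounded_vec_seq v"
    and A\<^sub>m_stable: "\<forall>\<mu> \<in> eigenvalues (complex_matrix A\<^sub>m). cmod \<mu> < 1"
    and A\<^sub>m_B\<Lambda>: "assumption1 A\<^sub>m (B ** \<Lambda>)"
    and \<Gamma>_symmetric: "Finite_Cartesian_Product.transpose \<Gamma> = \<Gamma>"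
    and \<Gamma>_pos_def: "\<And>x. x \<noteq> 0 \<Longrightarrow> 0 < x \<bullet> (\<Gamma> *v x)"
    and u_eq: "\<And>k. u k = Finite_Cartesian_Product.transpose (\<theta> k) *v v k"
    and \<xi>_step: "\<And>k. \<xi> (Suc k) = A\<^sub>m *v \<xi> k + (B ** \<Lambda>) *v u k - v k"
    and \<xi>\<^sub>m_step: "\<And>k. \<xi>\<^sub>m (Suc k) = A\<^sub>m *v \<xi>\<^sub>m k"
    and e_eq: "\<And>k. e k = \<xi> k - \<xi>\<^sub>m k"
    and \<sigma>_eq: "\<And>k. \<sigma> k =
      sqrt (1 + lambda_max (B ** \<Lambda> ** Finite_Cartesian_Product.transpose B) * (v k \<bullet> (\<Gamma> *v v k)))"
    and \<epsilon>_eq: "\<And>k. \<epsilon> k = (v k - (B ** \<Lambda>) *v u k) /\<^sub>R (\<sigma> k)\<^sup>2"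
    and \<theta>_step: "\<And>k. \<theta> (Suc k) =
      \<theta> k + \<Gamma> ** (columnvector (v k) :: real^1^'r) ** rowvector (\<epsilon> k) ** B"
  shows "(\<forall>k. e (Suc k) = A\<^sub>m *v e k +
            (B ** \<Lambda>) *v (Finite_Cartesian_Product.transpose (\<theta> k - ideal_parameter B \<Lambda>) *v v k))
       \<and> bounded_mat_seq \<theta> \<and> bounded_vec_seq e
       \<and> bounded_vec_seq \<xi> \<and> bounded_vec_seq \<xi>\<^sub>m \<and> bounded_vec_seq u \<and> bounded_vec_seq \<epsilon>
       \<and> e \<longlonglongrightarrow> 0"
proof -
  let ?S = "B ** \<Lambda> ** mat_transpose B" and ?I = "ideal_parameter B \<Lambda>"
  define T where "T k = \<theta> k - ?I" for k
  define w where "w k = (B ** \<Lambda>) *v (mat_transpose (T k) *v v k)" for k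
  \<comment> \<open>The ideal parameter makes \<open>B ** \<Lambda>\<close> reproduce
    \<open>v k\<close>, so the unknown parameter error enters only through a quantity computed from
    \<open>u\<close> and \<open>v\<close>.\<close>
  have w_eq: "w k = (B ** \<Lambda>) *v u k - v k" for k
  proof -
    have "mat_transpose (T k) *v v k = u k - mat_transpose ?I *v v k"
      by (simp add: T_def u_eq vec_eq_iff matrix_vector_mult_def Finite_Cartesian_Product.transpose_def
          left_diff_distrib sum_subtractf)
    moreover have "(B ** \<Lambda>) *v (mat_transpose ?I *v v k) = v k"
      using ideal_parameter_right_inverse[OF rank_B \<Lambda>_diagonal] \<Lambda>_entries
      by (simp add: matrix_vector_mul_assoc less_imp_neq[THEN not_sym] del: transpose_matrix_vector)
    ultimately show ?thesis by (simp add: w_def matrix_vector_mult_diff_distrib)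
  qed
  have e_step: "e (Suc k) = A\<^sub>m *v e k + w k" for k
    by (simp add: e_eq \<xi>_step \<xi>\<^sub>m_step w_eq matrix_vector_mult_diff_distrib)

  define q where "q k = v k \<bullet> (\<Gamma> *v v k)" for k
  have q_nonneg: "0 \<le> q k" for k
    using \<Gamma>_pos_def[of "v k"] by (cases "v k = 0") (auto simp: q_def)
  have \<Lambda>_sym: "mat_transpose \<Lambda> = \<Lambda>" using \<Lambda>_diagonal by (rule diagonal_symmetric)
  have S_sym: "mat_transpose ?S = ?S" by (simp add: matrix_transpose_mul \<Lambda>_sym matrix_mul_assoc)
  have S_nonneg: "0 \<le> x \<bullet> (?S *v x)" for x
  proof -
    have "x \<bullet> (?S *v x) = (mat_transpose B *v x) \<bullet> (\<Lambda> *v (mat_transpose B *v x))"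
      by (simp add: inner_matrix_mult_transpose[of x B] flip: matrix_vector_mul_assoc)
    also have "\<dots> = (\<Sum>j\<in>UNIV. \<Lambda> $ j $ j * ((mat_transpose B *v x) $ j)\<^sup>2)"
      by (simp add: inner_vec_def diagonal_mult_vec[OF \<Lambda>_diagonal] power2_eq_square
          mult.commute mult.left_commute)
    also have "\<dots> \<ge> 0" using \<Lambda>_entries by (intro sum_nonneg) (simp add: less_imp_le)
    finally show ?thesis .
  qed
  define \<mu> where "\<mu> = lambda_max ?S"
  have S_le: "x \<bullet> (?S *v x) \<le> \<mu> * (norm x)\<^sup>2" for x
    unfolding \<mu>_def by (rule quadratic_form_le_lambda_max[OF S_sym])
  \<comment> \<open>Any unit vector works; \<open>undefined\<close> is just some index.
    Nonnegativity makes the argument of the square root in \<sigma> at least 1.\<close>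
  have \<mu>_nonneg: "0 \<le> \<mu>"
    using S_le[of "axis undefined 1"] S_nonneg[of "axis undefined 1"] by simp
  have \<sigma>_sq: "(\<sigma> k)\<^sup>2 = 1 + \<mu> * q k" for k
    using \<mu>_nonneg q_nonneg[of k] by (simp add: \<sigma>_eq \<mu>_def q_def)
  have \<sigma>_ge1: "1 \<le> (\<sigma> k)\<^sup>2" for k
    using \<mu>_nonneg q_nonneg[of k] by (simp add: \<sigma>_sq)
  have w_eps: "w k = - ((\<sigma> k)\<^sup>2 *\<^sub>R \<epsilon> k)" for k
  proof -
    have "(\<sigma> k)\<^sup>2 * inverse ((\<sigma> k)\<^sup>2) = 1" using \<sigma>_ge1[of k] by (intro right_inverse) linarith
    then show ?thesis by (simp add: \<epsilon>_eq w_eq)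
  qed

  obtain P where P_sym: "mat_transpose P = P" and P_pos: "\<And>x. x \<noteq> 0 \<Longrightarrow> 0 < x \<bullet> (P *v x)"
    and P_\<Gamma>: "\<And>x. P *v (\<Gamma> *v x) = x"
    using pos_def_inverse[OF \<Gamma>_symmetric \<Gamma>_pos_def] by metis
  obtain p where p: "0 < p" "\<And>x. p * (norm x)\<^sup>2 \<le> x \<bullet> (P *v x)"
    using pos_def_lower_bound[OF P_sym P_pos] by metis
  define V where "V k = lyapunov \<Lambda> P (T k)" for k
  have V_ge: "\<Lambda> $ j $ j * p * (T k $ i $ j)\<^sup>2 \<le> V k" for i j k
    unfolding V_def using lyapunov_lower_bound[of \<Lambda> p P] \<Lambda>_entries p by blast
  have V_nonneg: "0 \<le> V k" for k
  proof -
    have "0 \<le> \<Lambda> $ j $ j * p * (T k $ i $ j)\<^sup>2" for i j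
      using \<Lambda>_entries[of j] p(1) by simp
    then show ?thesis using V_ge order_trans by blast
  qed
  \<comment> \<open>The cross term contributes \<open>- 2 * (1 + \<mu> * q k)\<close> times the
    squared norm of \<open>\<epsilon> k\<close>, the quadratic term at most
    \<open>\<mu> * q k\<close> times it. The normalisation by \<sigma> thus lets the first outweigh
    the second, whatever the size of \<open>v k\<close>.\<close>
  have V_step: "V (Suc k) \<le> V k - (norm (\<epsilon> k))\<^sup>2" for k
  proof -
    have "T (Suc k) = T k + \<Gamma> ** (columnvector (v k) :: real^1^'r) ** rowvector (\<epsilon> k) ** B"
      by (simp add: T_def \<theta>_step)
    then have "V (Suc k) = V k + 2 * (\<epsilon> k \<bullet> w k) + q k * (\<epsilon> k \<bullet> (?S *v \<epsilon> k))"
      unfolding V_def w_def q_def using lyapunov_update[where L = \<Lambda> and G = \<Gamma> and P = P]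
        \<Lambda>_diagonal P_sym P_\<Gamma> by metis
    also have "\<epsilon> k \<bullet> w k = - ((1 + \<mu> * q k) * (norm (\<epsilon> k))\<^sup>2)"
      by (simp add: w_eps \<sigma>_sq dot_square_norm)
    also have "q k * (\<epsilon> k \<bullet> (?S *v \<epsilon> k)) \<le> q k * (\<mu> * (norm (\<epsilon> k))\<^sup>2)"
      using S_le q_nonneg by (rule mult_left_mono)
    finally have "V (Suc k) \<le> V k - 2 * (norm (\<epsilon> k))\<^sup>2 - \<mu> * q k * (norm (\<epsilon> k))\<^sup>2"
      by (simp add: algebra_simps)
    moreover have "0 \<le> \<mu> * q k * (norm (\<epsilon> k))\<^sup>2" using \<mu>_nonneg q_nonneg by simp
    moreover have "0 \<le> (norm (\<epsilon> k))\<^sup>2" by simp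
    ultimately show ?thesis by linarith
  qed
  have \<epsilon>_lim: "\<epsilon> \<longlonglongrightarrow> 0"
    using telescoping_squares_tendsto_0[where V = V and a = "\<lambda>k. norm (\<epsilon> k)", OF V_step V_nonneg] by (rule tendsto_norm_zero_cancel)

  obtain K where K: "\<forall>k. norm (v k) \<le> K" using v_bounded by (rule bounded_vec_seq_norm)
  have "bounded_linear ((*v) \<Gamma>)" by simp
  then obtain c where c: "0 < c" "\<And>x. norm (\<Gamma> *v x) \<le> norm x * c"
    using bounded_linear.pos_bounded by blast
  \<comment> \<open>Boundedness of \<open>v\<close> bounds \<sigma>, which is what lets the
    convergence of \<epsilon> pass to \<open>w\<close>.\<close>
  have q_le: "q k \<le> K * (K * c)" for k
  proof -
    have "q k \<le> norm (v k) * norm (\<Gamma> *v v k)" unfolding q_def by (rule norm_cauchy_schwarz)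
    also have "\<dots> \<le> K * (K * c)"
      using K c norm_ge_zero[of "v k"] order_trans[OF norm_ge_zero, of "v k" K]
      by (intro mult_mono order_trans[OF c(2)[of "v k"]] mult_right_mono) (auto simp: less_imp_le)
    finally show ?thesis .
  qed
  have w_le: "norm (w k) \<le> (1 + \<mu> * (K * (K * c))) * norm (\<epsilon> k)" for k
    using mult_left_mono[OF q_le \<mu>_nonneg, of k] \<sigma>_ge1[of k]
    by (simp add: w_eps \<sigma>_sq mult_right_mono)
  have "(\<lambda>k. (1 + \<mu> * (K * (K * c))) * norm (\<epsilon> k)) \<longlonglongrightarrow> 0"
    using tendsto_norm_zero[OF \<epsilon>_lim] by (rule tendsto_mult_right_zero)
  then have w_lim: "w \<longlonglongrightarrow> 0"
    by (rule Lim_null_comparison[rotated]) (intro always_eventually allI w_le)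
  have e_lim: "e \<longlonglongrightarrow> 0" using A\<^sub>m_stable e_step w_lim by (rule stable_recursion_tendsto_0)
  \<comment> \<open>The reference state obeys the same stable recursion with zero input.\<close>
  have \<xi>\<^sub>m_lim: "\<xi>\<^sub>m \<longlonglongrightarrow> 0"
    using stable_recursion_tendsto_0[OF A\<^sub>m_stable, of \<xi>\<^sub>m "\<lambda>k. 0"] by (simp add: \<xi>\<^sub>m_step)
  have "(\<lambda>k. e k + \<xi>\<^sub>m k) \<longlonglongrightarrow> 0" using tendsto_add[OF e_lim \<xi>\<^sub>m_lim] by simp
  then have \<xi>_lim: "\<xi> \<longlonglongrightarrow> 0" by (simp add: e_eq)

  \<comment> \<open>The norm accounts for the shift by the ideal parameter. Each root bounds the
    entries of one column of \<open>T k\<close> through \<open>V 0\<close>, and summing the roots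
    gives a bound independent of the column.\<close>
  define D where "D = norm ?I + (\<Sum>j\<in>UNIV. sqrt (V 0 / (\<Lambda> $ j $ j * p)))"
  have V_le: "V k \<le> V 0" for k
  proof (induction k)
    case (Suc k)
    then show ?case using V_step[of k] zero_le_power2[of "norm (\<epsilon> k)"] by linarith
  qed simp
  have \<theta>_le: "\<bar>\<theta> k $ i $ j\<bar> \<le> D" for k i j
  proof -
    have "\<Lambda> $ j $ j * p * (T k $ i $ j)\<^sup>2 \<le> V 0" using V_ge V_le order_trans by blast
    then have "(T k $ i $ j)\<^sup>2 \<le> V 0 / (\<Lambda> $ j $ j * p)"
      using \<Lambda>_entries[of j] p(1) by (simp add: field_simps)
    then have "\<bar>T k $ i $ j\<bar> \<le> sqrt (V 0 / (\<Lambda> $ j $ j * p))" by (simp add: real_le_rsqrt)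
    also have "\<dots> \<le> (\<Sum>j\<in>UNIV. sqrt (V 0 / (\<Lambda> $ j $ j * p)))"
      using \<Lambda>_entries p(1) V_nonneg by (intro member_le_sum) (auto simp: less_imp_le)
    finally have "\<bar>T k $ i $ j\<bar> \<le> (\<Sum>j\<in>UNIV. sqrt (V 0 / (\<Lambda> $ j $ j * p)))" .
    moreover have "\<bar>?I $ i $ j\<bar> \<le> norm ?I"
      using component_le_norm_cart[of "?I $ i" j] Finite_Cartesian_Product.norm_nth_le[of ?I i] by linarith
    ultimately show ?thesis by (simp add: D_def T_def)
  qed
  have "\<bar>u k $ i\<bar> \<le> (\<Sum>j\<in>(UNIV :: 'r set). D * K)" for k i
  proof -
    have "\<bar>u k $ i\<bar> \<le> (\<Sum>j\<in>UNIV. \<bar>\<theta> k $ j $ i\<bar> * \<bar>v k $ j\<bar>)"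
      unfolding u_eq matrix_vector_mult_def Finite_Cartesian_Product.transpose_def
      by (simp add: order_trans[OF sum_abs] abs_mult)
    also have "\<dots> \<le> (\<Sum>j\<in>(UNIV :: 'r set). D * K)"
    proof (intro sum_mono mult_mono \<theta>_le)
      show "\<bar>v k $ j\<bar> \<le> K" for j using K component_le_norm_cart order_trans by blast
      \<comment> \<open>Nonnegative because \<open>D\<close> bounds an absolute value.\<close>
      show "0 \<le> D" for j :: 'r using \<theta>_le[of k j i] by linarith
    qed simp
    finally show ?thesis .
  qed
  then have "bounded_vec_seq u" by (rule bounded_vec_seqI)
  moreover have "bounded_mat_seq \<theta>" using \<theta>_le by (rule bounded_mat_seqI)
  \<comment> \<open>The signals other than \<theta> and \<open>u\<close> are bounded because they
    converge.\<close>
  ultimately show ?thesis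
    using e_step e_lim \<xi>_lim \<xi>\<^sub>m_lim \<epsilon>_lim tendsto_imp_bounded_vec_seq
    unfolding w_def T_def by blast
qed

end
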